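(* There is an absolute constant $C$ such that for every positive integer $r$ and every $m$ for which a $\mathrm{DD}^*(m,r)$ exists, \[ m\leq \tfrac{\sqrt{\pi}}{\sqrt{2}\,3^{1/4}}\,r+\tfrac{3^{5/6}\pi^{1/3}}{2^{4/3}}\,r^{2/3}+C\,r^{1/3}. \]
   Context: The hexagonal grid is the set of centres of a tiling of the plane by regular hexagons in which centres of hexagons sharing an edge are at Euclidean distance $1$; concretely it is the lattice $\{i(1,0)+j(-\tfrac12,\tfrac{\sqrt3}{2}) : i,j\in\mathbb{Z}\}\subset\mathbb{R}^2$. A $\mathrm{DD}^*(m,r)$ (Euclidean hexagonal distinct difference configuration) is a set of $m$ points ("dots") of the hexagonal grid such that (1) any two dots are at Euclidean distance at most $r$, and (2) the lines joining pairs of dots are pairwise distinct either in length or in slope; equivalently, the vectors $a-b$, over ordered pairs $(a,b)$ of distinct dots, are pairwise distinct. *)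

theory Defs
  imports "HOL-Analysis.Analysis"
begin

definition hex_grid :: "(real^2) set" where
  "hex_grid = {of_int i *\<^sub>R vector [1, 0] + of_int j *\<^sub>R vector [- 1/2, sqrt 3 / 2] | i j :: int. True}"

(* None is the slope of vertical lines. *)
definition slope :: "real^2 \<Rightarrow> real^2 \<Rightarrow> real option" where
  "slope a b = (if a $ 1 = b $ 1 then None else Some ((a $ 2 - b $ 2) / (a $ 1 - b $ 1)))"

definition DD_star :: "nat \<Rightarrow> real \<Rightarrow> (real^2) set \<Rightarrow> bool" where
  "DD_star m r D \<longleftrightarrow>
     D \<subseteq> hex_grid \<and> finite D \<and> card D = m \<and>
     (\<forall>a\<in>D. \<forall>b\<in>D. dist a b \<le> r) \<and>
     (\<forall>a\<in>D. \<forall>b\<in>D. \<forall>c\<in>D. \<forall>d\<in>D. a \<noteq> b \<longrightarrow> c \<noteq> d \<longrightarrow> {a, b} \<noteq> {c, d} \<longrightarrow>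
        dist a b \<noteq> dist c d \<or> slope a b \<noteq> slope c d)"

lemma dist_slope_eq_iff:
  fixes a b c d :: "real^2"
  assumes "a \<noteq> b" "c \<noteq> d"
  shows "dist a b = dist c d \<and> slope a b = slope c d \<longleftrightarrow> a - b = c - d \<or> a - b = d - c"
proof -
  define x y u v where "x = a $ 1 - b $ 1" and "y = a $ 2 - b $ 2"
    and "u = c $ 1 - d $ 1" and "v = c $ 2 - d $ 2"
  note defs = x_def y_def u_def v_def
  have d: "dist a b = dist c d \<longleftrightarrow> x\<^sup>2 + y\<^sup>2 = u\<^sup>2 + v\<^sup>2"
    by (simp add: dist_norm norm_eq_sqrt_inner inner_vec_def sum_2 defs power2_eq_square)
  have s: "slope a b = slope c d \<longleftrightarrow> (x = 0 \<and> u = 0) \<or> (x \<noteq> 0 \<and> u \<noteq> 0 \<and> y / x = v / u)"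
    by (auto simp: slope_def defs)
  have e: "a - b = c - d \<longleftrightarrow> x = u \<and> y = v" "a - b = d - c \<longleftrightarrow> x = - u \<and> y = - v"
    by (auto simp: vec_eq_iff forall_2 defs)
  have nz: "x \<noteq> 0 \<or> y \<noteq> 0" "u \<noteq> 0 \<or> v \<noteq> 0"
    using assms by (auto simp: vec_eq_iff forall_2 defs)
  have "(x = u \<and> y = v) \<or> (x = - u \<and> y = - v)"
    if 1: "x\<^sup>2 + y\<^sup>2 = u\<^sup>2 + v\<^sup>2" and 2: "x \<noteq> 0" "u \<noteq> 0" "y / x = v / u"
  proof -
    define k where "k = y / x"
    have y: "y = k * x" using 2(1) by (simp add: k_def)
    have v: "v = k * u" unfolding k_def 2(3) using 2(2) by simp
    have "(1 + k\<^sup>2) * x\<^sup>2 = (1 + k\<^sup>2) * u\<^sup>2" using 1 by (simp add: y v algebra_simps power_mult_distrib)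
    moreover have "1 + k\<^sup>2 \<noteq> 0" by (smt (verit) zero_le_power2)
    ultimately have "x\<^sup>2 = u\<^sup>2" by simp
    then show ?thesis by (auto simp: y v power2_eq_iff)
  qed
  moreover have "(x = u \<and> y = v) \<or> (x = - u \<and> y = - v)"
    if "x\<^sup>2 + y\<^sup>2 = u\<^sup>2 + v\<^sup>2" "x = 0" "u = 0"
    using that by (auto simp: power2_eq_iff)
  ultimately show ?thesis
    unfolding d s e by auto
qed

lemma DD_star_iff_differences:
  "DD_star m r D \<longleftrightarrow>
     D \<subseteq> hex_grid \<and> finite D \<and> card D = m \<and>
     (\<forall>a\<in>D. \<forall>b\<in>D. dist a b \<le> r) \<and>
     inj_on (\<lambda>(a, b). a - b) {(a, b). a \<in> D \<and> b \<in> D \<and> a \<noteq> b}"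
proof -
  have "(\<forall>a\<in>D. \<forall>b\<in>D. \<forall>c\<in>D. \<forall>d\<in>D. a \<noteq> b \<longrightarrow> c \<noteq> d \<longrightarrow> {a, b} \<noteq> {c, d} \<longrightarrow>
          dist a b \<noteq> dist c d \<or> slope a b \<noteq> slope c d) \<longleftrightarrow>
        inj_on (\<lambda>(a, b). a - b) {(a, b). a \<in> D \<and> b \<in> D \<and> a \<noteq> b}" (is "?L \<longleftrightarrow> ?R")
  proof
    assume L: ?L
    have "a = c \<and> b = d"
      if "a \<in> D" "b \<in> D" "c \<in> D" "d \<in> D" "a \<noteq> b" "c \<noteq> d" and eq: "a - b = c - d" for a b c d
    proof -
      have "{a, b} = {c, d}"
        using L that dist_slope_eq_iff[of a b c d] by blast
      moreover have "\<not> (a = d \<and> b = c)"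
      proof
        assume h: "a = d \<and> b = c"
        then have "2 *\<^sub>R (c - d) = 0" using eq by (simp add: algebra_simps scaleR_2)
        then show False using \<open>c \<noteq> d\<close> by simp
      qed
      ultimately show ?thesis by (auto simp: doubleton_eq_iff)
    qed
    then show ?R by (auto simp: inj_on_def)
  next
    assume R: ?R
    have inj: "a = c \<and> b = d"
      if "a \<in> D" "b \<in> D" "c \<in> D" "d \<in> D" "a \<noteq> b" "c \<noteq> d" "a - b = c - d" for a b c d
      using inj_onD[OF R, of "(a, b)" "(c, d)"] that by auto
    show ?L
    proof (intro ballI impI)
      fix a b c d
      assume h: "a \<in> D" "b \<in> D" "c \<in> D" "d \<in> D" "a \<noteq> b" "c \<noteq> d" "{a, b} \<noteq> {c, d}"
      have "a - b \<noteq> c - d" using inj[of a b c d] h by auto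
      moreover have "a - b \<noteq> d - c" using inj[of a b d c] h by auto
      ultimately show "dist a b \<noteq> dist c d \<or> slope a b \<noteq> slope c d"
        using dist_slope_eq_iff[of a b c d] h by blast
    qed
  qed
  then show ?thesis unfolding DD_star_def by simp
qed

end

theory Submission
  imports Defs
begin

text \<open>
  Slide a disc of radius \<open>s\<close> over the grid and count the dots it contains. If the disc has \<open>a\<close>
  grid points and \<open>N\<close> of its positions meet the \<open>m\<close> dots, the counts sum to \<open>a m\<close>; since a difference
  vector occurs at most once, their squares sum to at most \<open>a\<^sup>2 + a m\<close>. Cauchy--Schwarz gives
  \<open>a m\<^sup>2 \<le> N (a + m)\<close>. The \<open>N\<close> positions form a set of diameter at most \<open>r + 2 s\<close>, so the isodiametric
  inequality bounds \<open>\<surd>N\<close> by \<open>\<kappa> (r / 2 + s)\<close> up to a constant, where \<open>\<kappa>\<^sup>2 = 2 \<pi> / \<surd>3\<close>, while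
  \<open>a\<close> is \<open>\<kappa>\<^sup>2 s\<^sup>2 + O(s)\<close>. Hence \<open>m\<close> is at most \<open>\<kappa> r / 2 + \<kappa> s + r\<^sup>2 / (8 s\<^sup>2)\<close> up to lower order
  terms, which is minimal for \<open>s = (r\<^sup>2 / (4 \<kappa>))\<^sup>1\<^sup>/\<^sup>3\<close>.
\<close>

section \<open>Sets with distinct differences in an abelian group\<close>

lemma distinct_differences_card_le:
  fixes D S :: "'a::ab_group_add set"
  assumes fin: "finite D" "finite S"
    and inj: "inj_on (\<lambda>(a, b). a - b) {(a, b). a \<in> D \<and> b \<in> D \<and> a \<noteq> b}"
  shows "card S * (card D)\<^sup>2 \<le> card ((\<lambda>(d, s). d - s) ` (D \<times> S)) * (card S + card D)"
proof (cases "card S = 0")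
  case False
  define X where "X = (\<lambda>(d, s). d - s) ` (D \<times> S)"
  define T where "T x = {d \<in> D. d - x \<in> S}" for x
  have finX: "finite X" and finT: "finite (T x)" for x
    using fin by (auto simp: X_def T_def)
  \<comment> \<open>The pair \<open>(d, d - x)\<close> records a dot and its place in the window
    \<open>S\<close> translated by \<open>x\<close>. It determines \<open>x\<close>, so the counts
    can be summed dot by dot.\<close>
  have "bij_betw (\<lambda>(x, d). (d, d - x)) (SIGMA x:X. T x) (D \<times> S)"
    by (rule bij_betw_byWitness[where f' = "\<lambda>(d, s). (d - s, d)"]) (auto simp: X_def T_def image_def)
  then have sum1: "(\<Sum>x\<in>X. card (T x)) = card D * card S"
    using finX finT by (simp add: bij_betw_same_card card_cartesian_product flip: card_SigmaI)
  define P where "P = (SIGMA x:X. T x \<times> T x)"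
  define P1 where "P1 = {(x, d, d') \<in> P. d = d'}"
  define P2 where "P2 = {(x, d, d') \<in> P. d \<noteq> d'}"
  have "P = P1 \<union> P2" by (auto simp: P1_def P2_def)
  have "card P1 \<le> card (D \<times> S)"
    by (rule card_inj_on_le[where f = "\<lambda>(x, d, d'). (d, d - x)"])
       (use fin in \<open>auto simp: P1_def P_def T_def inj_on_def\<close>)
  \<comment> \<open>Off the diagonal, two recorded places suffice: their difference is
    \<open>d - d'\<close>, which determines \<open>(d, d')\<close> and with it
    \<open>x\<close>.\<close>
  moreover have "card P2 \<le> card (S \<times> S)"
  proof (rule card_inj_on_le[where f = "\<lambda>(x, d, d'). (d - x, d' - x)"])
    show "inj_on (\<lambda>(x, d, d'). (d - x, d' - x)) P2"
    proof (rule inj_onI)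
      fix p q
      assume pq: "p \<in> P2" "q \<in> P2"
        "(\<lambda>(x, d, d'). (d - x, d' - x)) p = (\<lambda>(x, d, d'). (d - x, d' - x)) q"
      obtain x d d' y e e' where p: "p = (x, d, d')" and q: "q = (y, e, e')"
        by (cases p, cases q) auto
      have h: "(x, d, d') \<in> P2" "(y, e, e') \<in> P2" "d - x = e - y" "d' - x = e' - y"
        using pq by (simp_all add: p q)
      have "d - d' = (d - x) - (d' - x)" by simp
      also have "\<dots> = e - e'" by (simp add: h(3,4))
      finally have "(d, d') = (e, e')"
        by (intro inj_onD[OF inj]) (use h(1,2) in \<open>auto simp: P2_def P_def T_def\<close>)
      with h(3) show "p = q" by (simp add: p q)
    qed
  qed (use fin in \<open>auto simp: P2_def P_def T_def\<close>)
  ultimately have "card P \<le> card D * card S + card S * card S"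
    unfolding \<open>P = P1 \<union> P2\<close> using card_Un_le[of P1 P2] by (simp add: card_cartesian_product)
  moreover have "card P = (\<Sum>x\<in>X. (card (T x))\<^sup>2)"
    using finX finT by (simp add: P_def card_cartesian_product power2_eq_square)
  ultimately have sum2: "(\<Sum>x\<in>X. (card (T x))\<^sup>2) \<le> card D * card S + card S * card S" by simp
  have "(\<Sum>x\<in>X. real (card (T x)))\<^sup>2 \<le> (\<Sum>x\<in>X. (real (card (T x)))\<^sup>2) * card X"
    by (rule sum_squared_le_sum_of_squares)
  then have "real ((\<Sum>x\<in>X. card (T x))\<^sup>2) \<le> real ((\<Sum>x\<in>X. (card (T x))\<^sup>2) * card X)"
    by simp
  then have "(card D * card S)\<^sup>2 \<le> (\<Sum>x\<in>X. (card (T x))\<^sup>2) * card X"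
    unfolding of_nat_le_iff sum1 .
  also have "\<dots> \<le> (card D * card S + card S * card S) * card X"
    using sum2 by (rule mult_right_mono) simp
  \<comment> \<open>Cancelling the common factor \<open>card S\<close> is what requires splitting
    off \<open>card S = 0\<close>.\<close>
  finally have "card S * (card S * (card D)\<^sup>2) \<le> card S * (card X * (card S + card D))"
    by (simp add: power2_eq_square algebra_simps)
  with False show ?thesis by (simp add: X_def)
qed simp

section \<open>The isodiametric inequality in the plane\<close>

text \<open>Steiner symmetrization in the vertical direction. The inequality is strict so that fibres over
  empty sections stay empty, which keeps the diameter under control.\<close>

definition steiner :: "(real \<times> real) set \<Rightarrow> (real \<times> real) set" where
  "steiner A = {(x, y). 2 * \<bar>y\<bar> < measure lborel (Pair x -` A)}"

lemma sets_lborel_pair: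
  fixes A :: "('a::euclidean_space \<times> 'b::euclidean_space) set"
  assumes "A \<in> sets borel"
  shows "A \<in> sets (lborel \<Otimes>\<^sub>M lborel)"
  unfolding lborel_prod using assms by simp

lemma sets_lborel_section:
  fixes A :: "(real \<times> real) set"
  assumes "A \<in> sets borel"
  shows "Pair x -` A \<in> sets borel"
  using sets_Pair1[OF sets_lborel_pair[OF assms]] by simp

lemma steiner_measurable:
  assumes A: "A \<in> sets borel"
  shows "steiner A \<in> sets borel"
proof -
  have "(\<lambda>x. emeasure lborel (Pair x -` A)) \<in> borel_measurable (lborel :: real measure)"
    by (rule lborel.measurable_emeasure_Pair) (rule sets_lborel_pair[OF A])
  then have l[measurable]: "(\<lambda>x. measure lborel (Pair x -` A)) \<in> borel_measurable borel"
    unfolding measure_def by simp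
  have "{p \<in> space (borel \<Otimes>\<^sub>M borel). 2 * \<bar>snd p\<bar> < measure lborel (Pair (fst p) -` A)}
      \<in> sets (borel \<Otimes>\<^sub>M borel)"
    by measurable
  moreover have "{p \<in> space (borel \<Otimes>\<^sub>M borel). 2 * \<bar>snd p\<bar> < measure lborel (Pair (fst p) -` A)}
      = steiner A"
    by (auto simp: steiner_def space_pair_measure)
  ultimately show ?thesis unfolding borel_prod by metis
qed

lemma bounded_section:
  fixes A :: "(real \<times> real) set"
  assumes "bounded A"
  shows "bounded (Pair x -` A)"
proof -
  have "Pair x -` A \<subseteq> snd ` A" by force
  with assms show ?thesis using bounded_snd bounded_subset by blast
qed

text \<open>Cavalieri's principle, as vertical sections keep their length. Boundedness makes these
  lengths finite; \<open>measure\<close> would turn an infinite one into 0.\<close>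

lemma emeasure_steiner:
  assumes A: "A \<in> sets borel" "bounded A"
  shows "emeasure lborel (steiner A) = emeasure lborel A"
proof -
  have sec: "emeasure lborel (Pair x -` steiner A) = emeasure lborel (Pair x -` A)" for x
  proof -
    define l where "l = measure lborel (Pair x -` A)"
    have "Pair x -` steiner A = {- l / 2 <..< l / 2}"
      by (auto simp: steiner_def l_def)
    then have "emeasure lborel (Pair x -` steiner A) = ennreal l"
      by (simp add: l_def)
    also have "\<dots> = emeasure lborel (Pair x -` A)"
      using emeasure_bounded_finite[OF bounded_section[OF A(2), of x]]
      by (simp add: l_def emeasure_eq_ennreal_measure)
    finally show ?thesis .
  qed
  have "emeasure (lborel \<Otimes>\<^sub>M lborel) (steiner A) = emeasure (lborel \<Otimes>\<^sub>M lborel) A"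
    unfolding lborel.emeasure_pair_measure_alt[OF sets_lborel_pair[OF steiner_measurable[OF A(1)]]]
      lborel.emeasure_pair_measure_alt[OF sets_lborel_pair[OF A(1)]] sec ..
  then show ?thesis by (simp add: lborel_prod)
qed

text \<open>Each length is at most \<open>Sup - Inf\<close>. Regrouping the sum as
  \<open>(Sup U - Inf V) + (Sup V - Inf U)\<close> leaves two terms that are at most
  \<open>t\<close>.\<close>

lemma measure_section_add_le:
  fixes U V :: "real set"
  assumes ne: "U \<noteq> {}" "V \<noteq> {}" and bd: "bounded U" "bounded V"
    and t: "\<And>u v. u \<in> U \<Longrightarrow> v \<in> V \<Longrightarrow> \<bar>u - v\<bar> \<le> t"
    and meas: "U \<in> sets borel" "V \<in> sets borel"
  shows "measure lborel U + measure lborel V \<le> 2 * t"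
proof -
  have len: "measure lborel W \<le> Sup W - Inf W" if "W \<noteq> {}" "bounded W" "W \<in> sets borel" for W :: "real set"
  proof -
    have "bdd_below W" "bdd_above W" using that by (auto simp: bounded_imp_bdd_below bounded_imp_bdd_above)
    then have "W \<subseteq> {Inf W..Sup W}" by (auto intro: cInf_lower cSup_upper)
    moreover have "Inf W \<le> Sup W" using that \<open>bdd_below W\<close> \<open>bdd_above W\<close> by (simp add: cInf_le_cSup)
    ultimately have "measure lborel W \<le> measure lborel {Inf W..Sup W}"
      by (intro measure_mono_fmeasurable) (use that in \<open>auto simp: fmeasurable_def\<close>)
    then show ?thesis using \<open>Inf W \<le> Sup W\<close> by simp
  qed
  have sep: "Sup U' - Inf V' \<le> t" if "U' \<noteq> {}" "V' \<noteq> {}"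
    and t': "\<And>u v. u \<in> U' \<Longrightarrow> v \<in> V' \<Longrightarrow> \<bar>u - v\<bar> \<le> t" for U' V' :: "real set"
  proof -
    have "Sup U' \<le> v + t" if "v \<in> V'" for v
      using \<open>U' \<noteq> {}\<close> by (rule cSup_least) (use t'[OF _ that] in \<open>force simp: abs_le_iff\<close>)
    then have "Sup U' - t \<le> Inf V'"
      by (intro cInf_greatest) (use \<open>V' \<noteq> {}\<close> in \<open>auto simp: algebra_simps\<close>)
    then show ?thesis by simp
  qed
  have "Sup U - Inf V \<le> t" using ne t by (intro sep) auto
  moreover have "Sup V - Inf U \<le> t"
    using ne by (intro sep) (use t abs_minus_commute in \<open>metis+\<close>)
  ultimately show ?thesis using len[of U] len[of V] assms by linarith
qed

text \<open>Points of \<open>A\<close> over \<open>x\<close> and \<open>x'\<close> differ in height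
  by at most \<open>t\<close>, so the two section lengths sum to at most \<open>2 * t\<close>.
  Centring the sections gives heights \<open>y\<close>, \<open>y'\<close> below half their lengths,
  hence again at most \<open>t\<close> apart.\<close>

lemma dist_steiner_le:
  assumes A: "A \<in> sets borel" "bounded A" and d: "\<And>p q. p \<in> A \<Longrightarrow> q \<in> A \<Longrightarrow> dist p q \<le> d"
    and pq: "p \<in> steiner A" "q \<in> steiner A"
  shows "dist p q \<le> d"
proof -
  obtain x y x' y' where p: "p = (x, y)" and q: "q = (x', y')" by fastforce
  define U V where "U = Pair x -` A" and "V = Pair x' -` A"
  have UV: "2 * \<bar>y\<bar> < measure lborel U" "2 * \<bar>y'\<bar> < measure lborel V"
    using pq by (auto simp: p q steiner_def U_def V_def)
  then have ne: "U \<noteq> {}" "V \<noteq> {}" by auto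
  have D: "(x - x')\<^sup>2 + (u - v)\<^sup>2 \<le> d\<^sup>2" if "u \<in> U" "v \<in> V" for u v
  proof -
    have "dist (x, u) (x', v) \<le> d" using that by (intro d) (auto simp: U_def V_def)
    then have "(dist (x, u) (x', v))\<^sup>2 \<le> d\<^sup>2" by (intro power_mono) auto
    then show ?thesis by (simp add: dist_Pair_Pair dist_real_def)
  qed
  define t where "t = sqrt (d\<^sup>2 - (x - x')\<^sup>2)"
  have t: "\<bar>u - v\<bar> \<le> t" if "u \<in> U" "v \<in> V" for u v
    unfolding t_def using D[OF that] by (intro real_le_rsqrt) simp
  have "measure lborel U + measure lborel V \<le> 2 * t"
    using ne t A by (intro measure_section_add_le)
      (auto simp: U_def V_def bounded_section sets_lborel_section)
  then have "\<bar>y - y'\<bar> \<le> t" using UV by linarith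
  then have "(y - y')\<^sup>2 \<le> t\<^sup>2" by (metis abs_ge_zero power2_abs power_mono)
  \<comment> \<open>Actual points of the two sections certify that the radicand is
    nonnegative.\<close>
  also have "t\<^sup>2 = d\<^sup>2 - (x - x')\<^sup>2"
  proof -
    obtain u v where "u \<in> U" "v \<in> V" using ne by auto
    with D[of u v] have "0 \<le> d\<^sup>2 - (x - x')\<^sup>2" using zero_le_power2[of "u - v"] by linarith
    then show ?thesis by (simp add: t_def)
  qed
  finally have "(dist p q)\<^sup>2 \<le> d\<^sup>2" by (simp add: p q dist_Pair_Pair dist_real_def)
  moreover have "0 \<le> d" using d ne U_def by (metis all_not_in_conv dist_self vimage_eq)
  ultimately show ?thesis by (rule power2_le_imp_le)
qed

text \<open>Steiner's argument: symmetrizing in both directions keeps the area, does not increase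
  the diameter, and makes the set symmetric about the origin. It then lies in the disc of radius
  \<open>d / 2\<close>. Swapping coordinates in \<open>B\<close> lets \<open>steiner\<close> serve
  both directions.\<close>

theorem isodiametric_plane:
  fixes A :: "(real \<times> real) set"
  assumes A: "A \<in> sets borel" and d: "\<And>p q. p \<in> A \<Longrightarrow> q \<in> A \<Longrightarrow> dist p q \<le> d" and "0 \<le> d"
  shows "emeasure lborel A \<le> ennreal (pi * (d / 2)\<^sup>2)"
proof -
  have bd: "bounded B" if "\<And>p q. p \<in> B \<Longrightarrow> q \<in> B \<Longrightarrow> dist p q \<le> d" for B :: "(real \<times> real) set"
    using that unfolding bounded_two_points by blast
  have Ab: "bounded A" using d by (rule bd)
  define B where "B = prod.swap -` steiner A"
  have swap: "prod.swap \<in> borel_measurable (borel :: (real \<times> real) measure)"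
    by (intro borel_measurable_continuous_onI) (auto simp: prod.swap_def intro!: continuous_intros)
  have Bm: "B \<in> sets borel"
    using measurable_sets[OF swap steiner_measurable[OF A]] by (simp add: B_def)
  have Bd: "dist p q \<le> d" if "p \<in> B" "q \<in> B" for p q
  proof -
    have "dist (prod.swap p) (prod.swap q) \<le> d"
      using that by (intro dist_steiner_le[OF A Ab d]) (simp_all add: B_def)
    then show ?thesis by (simp add: dist_prod_def add.commute)
  qed
  have Bb: "bounded B" using Bd by (rule bd)
  have sec: "Pair y -` B = (\<lambda>x. (x, y)) -` steiner A" for y by (auto simp: B_def)
  \<comment> \<open>By Fubini, integrating over the other variable first shows that the swap
    preserves area.\<close>
  have "emeasure lborel B = emeasure (lborel \<Otimes>\<^sub>M lborel) B" by (simp add: lborel_prod)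
  also have "\<dots> = (\<integral>\<^sup>+ y. emeasure lborel ((\<lambda>x. (x, y)) -` steiner A) \<partial>lborel)"
    unfolding lborel.emeasure_pair_measure_alt[OF sets_lborel_pair[OF Bm]] sec ..
  also have "\<dots> = emeasure (lborel \<Otimes>\<^sub>M lborel) (steiner A)"
    unfolding lborel_pair.emeasure_pair_measure_alt2[OF sets_lborel_pair[OF steiner_measurable[OF A]]] ..
  also have "\<dots> = emeasure lborel A" by (simp add: lborel_prod emeasure_steiner A Ab)
  finally have "emeasure lborel A = emeasure lborel (steiner B)"
    by (simp add: emeasure_steiner Bm Bb)
  also have "\<dots> \<le> emeasure lborel (cball (0 :: real \<times> real) (d / 2))"
  proof (rule emeasure_mono)
    show "steiner B \<subseteq> cball 0 (d / 2)"
    proof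
      fix p assume p: "p \<in> steiner B"
      txt \<open>Symmetrizing in both directions yields a centrally symmetric set.\<close>
      have "Pair (- y) -` B = Pair y -` B" for y by (auto simp: B_def steiner_def)
      with p have "- p \<in> steiner B" by (auto simp: steiner_def)
      then have "dist p (- p) \<le> d" using p by (intro dist_steiner_le[OF Bm Bb Bd])
      then have "norm (2 *\<^sub>R p) \<le> d" by (simp add: dist_norm scaleR_2)
      then show "p \<in> cball 0 (d / 2)" by simp
    qed
  qed simp
  also have "\<dots> = ennreal (pi * (d / 2)\<^sup>2)"
    using \<open>0 \<le> d\<close> by (simp add: emeasure_cball unit_ball_vol_2 power2_eq_square)
  finally show ?thesis .
qed

section \<open>Counting points of the hexagonal lattice\<close>

text \<open>A copy of \<open>hex_grid\<close> in the product type, where \<open>lborel\<close> is a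
  product measure and sections are available.\<close>

definition hex_lattice :: "(real \<times> real) set" where
  "hex_lattice = {(of_int i - of_int j / 2, sqrt 3 / 2 * of_int j) | i j :: int. True}"

text \<open>The rows of the lattice are horizontal, so the plane is tiled by rectangles of size
  \<open>1 \<times> \<surd>3/2\<close> centred at the lattice points, laid like bricks.\<close>

definition brick :: "real \<times> real \<Rightarrow> (real \<times> real) set" where
  "brick p = {fst p - 1/2 ..< fst p + 1/2} \<times> {snd p - sqrt 3 / 4 ..< snd p + sqrt 3 / 4}"

lemma brick_sets: "brick p \<in> sets borel"
proof -
  have "brick p \<in> sets (borel \<Otimes>\<^sub>M borel)" unfolding brick_def by simp
  then show ?thesis by (simp only: borel_prod)
qed

lemma emeasure_brick: "emeasure lborel (brick p) = ennreal (sqrt 3 / 2)"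
proof -
  have "emeasure (lborel \<Otimes>\<^sub>M lborel) (brick p) = ennreal (sqrt 3 / 2)"
    unfolding brick_def by (subst lborel.emeasure_pair_measure_Times) (simp_all flip: ennreal_mult)
  then show ?thesis by (simp add: lborel_prod)
qed

text \<open>The half diagonal is \<open>sqrt 7 / 4\<close>; rounding it up to 1 affects only lower
  order terms.\<close>

lemma dist_brick_le: "q \<in> brick p \<Longrightarrow> dist p q \<le> 1"
proof -
  assume "q \<in> brick p"
  then have h: "\<bar>fst p - fst q\<bar> \<le> 1/2" "\<bar>snd p - snd q\<bar> \<le> sqrt 3 / 4"
    unfolding brick_def mem_Times_iff abs_le_iff by auto
  have "(fst p - fst q)\<^sup>2 \<le> (1/2)\<^sup>2" "(snd p - snd q)\<^sup>2 \<le> (sqrt 3 / 4)\<^sup>2"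
    using h by (metis abs_ge_zero power2_abs power_mono)+
  then have "(fst p - fst q)\<^sup>2 + (snd p - snd q)\<^sup>2 \<le> 1"
    by (simp add: power_divide)
  then show ?thesis by (simp add: dist_prod_def dist_real_def)
qed

text \<open>Rows lie one brick height apart, so a common point forces equal rows; within a row the
  spacing is one brick width.\<close>

lemma brick_disjoint:
  assumes "p \<in> hex_lattice" "p' \<in> hex_lattice" "q \<in> brick p" "q \<in> brick p'"
  shows "p = p'"
proof -
  obtain i j i' j' :: int where p: "p = (of_int i - of_int j / 2, sqrt 3 / 2 * of_int j)"
    and p': "p' = (of_int i' - of_int j' / 2, sqrt 3 / 2 * of_int j')"
    using assms(1,2) by (auto simp: hex_lattice_def)
  have "\<bar>sqrt 3 / 2 * of_int j - sqrt 3 / 2 * of_int j'\<bar> < sqrt 3 / 2"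
    using assms(3,4) unfolding brick_def p p' mem_Times_iff abs_less_iff by auto
  then have "sqrt 3 / 2 * \<bar>of_int j - of_int j'\<bar> < sqrt 3 / 2 * 1"
    unfolding right_diff_distrib[symmetric] abs_mult by simp
  then have "\<bar>of_int j - of_int j' :: real\<bar> < 1" by (subst (asm) mult_less_cancel_left_pos) auto
  then have j: "j = j'" by linarith
  have "\<bar>of_int i - of_int i' :: real\<bar> < 1"
    using assms(3,4) unfolding brick_def p p' j mem_Times_iff abs_less_iff by auto
  then have "i = i'" by linarith
  with j show ?thesis by (simp add: p p')
qed

lemma brick_cover: "\<exists>p\<in>hex_lattice. q \<in> brick p"
proof -
  \<comment> \<open>Round to the nearest row first; then round within it, allowing for its shift by
    \<open>j / 2\<close>.\<close>
  define j where "j = \<lfloor>2 * snd q / sqrt 3 + 1/2\<rfloor>"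
  define i where "i = \<lfloor>fst q + of_int j / 2 + 1/2\<rfloor>"
  have "of_int j \<le> 2 * snd q / sqrt 3 + 1/2" "2 * snd q / sqrt 3 + 1/2 < of_int j + 1"
    unfolding j_def by linarith+
  then have "sqrt 3 / 2 * of_int j - sqrt 3 / 4 \<le> snd q" "snd q < sqrt 3 / 2 * of_int j + sqrt 3 / 4"
    by (simp_all add: field_simps)
  moreover have "of_int i - of_int j / 2 - 1/2 \<le> fst q" "fst q < of_int i - of_int j / 2 + 1/2"
    unfolding i_def by linarith+
  ultimately have "q \<in> brick (of_int i - of_int j / 2, sqrt 3 / 2 * of_int j)"
    by (auto simp: brick_def mem_Times_iff)
  then show ?thesis unfolding hex_lattice_def by blast
qed

lemma emeasure_bricks:
  assumes "finite X" "X \<subseteq> hex_lattice"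
  shows "emeasure lborel (\<Union>p\<in>X. brick p) = ennreal (card X * (sqrt 3 / 2))"
proof -
  have "emeasure lborel (\<Union>p\<in>X. brick p) = (\<Sum>p\<in>X. emeasure lborel (brick p))"
  proof (rule sum_emeasure[symmetric])
    show "disjoint_family_on brick X"
      unfolding disjoint_family_on_def using assms(2) brick_disjoint by blast
  qed (use assms(1) brick_sets in auto)
  also have "\<dots> = (\<Sum>p\<in>X. ennreal (sqrt 3 / 2))" by (simp add: emeasure_brick)
  also have "\<dots> = ennreal (card X * (sqrt 3 / 2))" by (subst sum_ennreal) simp_all
  finally show ?thesis .
qed

text \<open>The bricks of \<open>X\<close> have total area \<open>card X * (sqrt 3 / 2)\<close>, and
  their union has diameter at most \<open>t + 2\<close>.\<close>

lemma card_hex_lattice_diameter_le: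
  assumes X: "finite X" "X \<subseteq> hex_lattice" and t: "\<And>p q. p \<in> X \<Longrightarrow> q \<in> X \<Longrightarrow> dist p q \<le> t" and "0 \<le> t"
  shows "card X * (sqrt 3 / 2) \<le> pi * (t / 2 + 1)\<^sup>2"
proof -
  have "emeasure lborel (\<Union>p\<in>X. brick p) \<le> ennreal (pi * ((t + 2) / 2)\<^sup>2)"
  proof (rule isodiametric_plane)
    fix u v assume "u \<in> (\<Union>p\<in>X. brick p)" "v \<in> (\<Union>p\<in>X. brick p)"
    then obtain p q where pq: "p \<in> X" "u \<in> brick p" "q \<in> X" "v \<in> brick q" by auto
    show "dist u v \<le> t + 2"
      using t[OF pq(1,3)] dist_brick_le[OF pq(2)] dist_brick_le[OF pq(4)]
      by (smt (verit) dist_commute dist_triangle)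
  qed (use X brick_sets \<open>0 \<le> t\<close> in auto)
  then have "ennreal (card X * (sqrt 3 / 2)) \<le> ennreal (pi * ((t + 2) / 2)\<^sup>2)"
    by (simp only: emeasure_bricks[OF X])
  then have "card X * (sqrt 3 / 2) \<le> pi * ((t + 2) / 2)\<^sup>2"
    by (subst (asm) ennreal_le_iff) simp_all
  then show ?thesis by (simp add: add_divide_distrib)
qed

text \<open>Finite subsets have diameter at most \<open>2 * s\<close>, so the preceding bound limits
  their cardinality uniformly.\<close>

lemma finite_hex_lattice_cball: "finite (hex_lattice \<inter> cball 0 s)"
proof (cases "0 \<le> s")
  case True
  show ?thesis
  proof (rule finite_if_finite_subsets_card_bdd[THEN conjunct1])
    fix X assume X: "X \<subseteq> hex_lattice \<inter> cball 0 s" "finite X"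
    have "dist p q \<le> 2 * s" if "p \<in> X" "q \<in> X" for p q
    proof -
      have "norm p \<le> s" "norm q \<le> s" using that X by auto
      then show ?thesis using norm_triangle_ineq4[of p q] by (simp add: dist_norm)
    qed
    then have "card X * (sqrt 3 / 2) \<le> pi * (s + 1)\<^sup>2"
      using card_hex_lattice_diameter_le[of X "2 * s"] X True by auto
    then have "real (card X) \<le> pi * (s + 1)\<^sup>2 * 2 / sqrt 3" by (simp add: field_simps)
    then show "card X \<le> nat \<lceil>pi * (s + 1)\<^sup>2 * 2 / sqrt 3\<rceil>" by linarith
  qed
qed (simp add: not_le)

text \<open>A brick that meets the disc of radius \<open>s - 1\<close> has its centre in the disc of
  radius \<open>s\<close>, so the bricks counted cover the smaller disc.\<close>

lemma card_hex_lattice_cball_ge: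
  assumes "1 \<le> s"
  shows "pi * (s - 1)\<^sup>2 \<le> card (hex_lattice \<inter> cball 0 s) * (sqrt 3 / 2)"
proof -
  define S where "S = hex_lattice \<inter> cball 0 s"
  have "ennreal (pi * (s - 1)\<^sup>2) = emeasure lborel (cball (0 :: real \<times> real) (s - 1))"
    using assms by (simp add: emeasure_cball unit_ball_vol_2 power2_eq_square)
  also have "\<dots> \<le> emeasure lborel (\<Union>p\<in>S. brick p)"
  proof (rule emeasure_mono)
    show "cball 0 (s - 1) \<subseteq> (\<Union>p\<in>S. brick p)"
    proof
      fix q :: "real \<times> real" assume q: "q \<in> cball 0 (s - 1)"
      obtain p where p: "p \<in> hex_lattice" "q \<in> brick p" using brick_cover by blast
      have "dist 0 p \<le> dist 0 q + dist p q" using dist_triangle2 by blast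
      also have "\<dots> \<le> s" using q dist_brick_le[OF p(2)] by simp
      finally show "q \<in> (\<Union>p\<in>S. brick p)" using p by (auto simp: S_def)
    qed
    have "finite S" unfolding S_def by (rule finite_hex_lattice_cball)
    then show "(\<Union>p\<in>S. brick p) \<in> sets lborel" using brick_sets by auto
  qed
  also have "\<dots> = ennreal (card S * (sqrt 3 / 2))"
    by (rule emeasure_bricks) (auto simp: S_def finite_hex_lattice_cball)
  finally show ?thesis by (subst (asm) ennreal_le_iff) (simp_all add: S_def)
qed

section \<open>From configurations to lattice counts\<close>

lemma hex_lattice_diff: "p \<in> hex_lattice \<Longrightarrow> q \<in> hex_lattice \<Longrightarrow> p - q \<in> hex_lattice"
proof -
  assume "p \<in> hex_lattice" "q \<in> hex_lattice"
  then obtain i j i' j' :: int where p: "p = (of_int i - of_int j / 2, sqrt 3 / 2 * of_int j)"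
    and q: "q = (of_int i' - of_int j' / 2, sqrt 3 / 2 * of_int j')"
    by (auto simp: hex_lattice_def)
  have "p - q = (of_int (i - i') - of_int (j - j') / 2, sqrt 3 / 2 * of_int (j - j'))"
    by (simp add: p q field_simps)
  then show ?thesis unfolding hex_lattice_def by blast
qed

lemma hex_grid_imp_hex_lattice: "v \<in> hex_grid \<Longrightarrow> (v $ 1, v $ 2) \<in> hex_lattice"
  by (fastforce simp: hex_grid_def hex_lattice_def)

text \<open>Here \<open>a\<close> counts the lattice points of the disc of radius \<open>s\<close>,
  and \<open>N\<close> counts its positions that meet \<open>D\<close>. Each position is within
  \<open>s\<close> of a dot, so the positions have diameter at most
  \<open>r + 2 * s\<close>.\<close>

lemma DD_star_count:
  assumes D: "DD_star m r D" and s: "1 \<le> s" and r: "0 \<le> r"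
  obtains N a :: nat where "a * m\<^sup>2 \<le> N * (a + m)"
    and "N * (sqrt 3 / 2) \<le> pi * (r / 2 + s + 1)\<^sup>2"
    and "pi * (s - 1)\<^sup>2 \<le> a * (sqrt 3 / 2)"
proof -
  \<comment> \<open>An additive isometry onto the product plane, which carries distances and
    distinct differences over.\<close>
  define \<phi> where "\<phi> v = (v $ 1, v $ 2)" for v :: "real^2"
  have \<phi>_inj: "\<phi> v = \<phi> w \<longleftrightarrow> v = w" for v w by (auto simp: \<phi>_def vec_eq_iff forall_2)
  have \<phi>_diff: "\<phi> v - \<phi> w = \<phi> (v - w)" for v w by (simp add: \<phi>_def)
  have \<phi>_dist: "dist (\<phi> v) (\<phi> w) = dist v w" for v w
    by (simp add: \<phi>_def dist_Pair_Pair dist_vec_def L2_set_def sum_2)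
  note D' = D[unfolded DD_star_iff_differences]
  define S where "S = hex_lattice \<inter> cball 0 s"
  define X where "X = (\<lambda>(d, s). d - s) ` (\<phi> ` D \<times> S)"
  have finS: "finite S" unfolding S_def by (rule finite_hex_lattice_cball)
  have inj: "inj_on (\<lambda>(a, b). a - b) {(a, b). a \<in> \<phi> ` D \<and> b \<in> \<phi> ` D \<and> a \<noteq> b}"
  proof (rule inj_onI)
    fix p q
    assume pq: "p \<in> {(a, b). a \<in> \<phi> ` D \<and> b \<in> \<phi> ` D \<and> a \<noteq> b}"
      "q \<in> {(a, b). a \<in> \<phi> ` D \<and> b \<in> \<phi> ` D \<and> a \<noteq> b}"
      "(\<lambda>(a, b). a - b) p = (\<lambda>(a, b). a - b) q"
    obtain a b where p: "p = (\<phi> a, \<phi> b)" "a \<in> D" "b \<in> D" "a \<noteq> b" using pq(1) by blast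
    obtain a' b' where q: "q = (\<phi> a', \<phi> b')" "a' \<in> D" "b' \<in> D" "a' \<noteq> b'" using pq(2) by blast
    have "a - b = a' - b'" using pq(3) by (simp only: p(1) q(1) prod.case \<phi>_diff \<phi>_inj)
    then have "(a, b) = (a', b')"
      using p q D' inj_onD[of "\<lambda>(a, b). a - b" "{(a, b). a \<in> D \<and> b \<in> D \<and> a \<noteq> b}" "(a, b)" "(a', b')"]
      by simp
    then show "p = q" by (simp add: p q)
  qed
  have "inj_on \<phi> D" by (rule inj_onI) (simp only: \<phi>_inj)
  then have cardD: "card (\<phi> ` D) = m" using D' by (simp add: card_image)
  have 1: "card S * m\<^sup>2 \<le> card X * (card S + m)"
    using distinct_differences_card_le[OF _ finS inj] D' by (simp add: cardD X_def)
  have X_diam: "dist p q \<le> r + 2 * s" if pX: "p \<in> X" and qX: "q \<in> X" for p q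
  proof -
    obtain a b u v where h: "a \<in> D" "b \<in> D" "u \<in> S" "v \<in> S" "p = \<phi> a - u" "q = \<phi> b - v"
      using pX qX by (auto simp: X_def)
    have "norm u \<le> s" "norm v \<le> s" using h by (auto simp: S_def)
    have "norm (\<phi> a - \<phi> b) \<le> r" using D' h \<phi>_dist[of a b] by (simp add: dist_norm)
    moreover have "p - q = (\<phi> a - \<phi> b) - (u - v)" by (simp add: h)
    ultimately show ?thesis
      using \<open>norm u \<le> s\<close> \<open>norm v \<le> s\<close> norm_triangle_ineq4[of "\<phi> a - \<phi> b" "u - v"]
        norm_triangle_ineq4[of u v] by (simp add: dist_norm)
  qed
  have \<phi>_lattice: "\<phi> v \<in> hex_lattice" if "v \<in> D" for v
    unfolding \<phi>_def using D' that by (intro hex_grid_imp_hex_lattice) blast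
  have "X \<subseteq> hex_lattice"
  proof
    fix p assume "p \<in> X"
    then obtain v u where "v \<in> D" "u \<in> hex_lattice" "p = \<phi> v - u" by (auto simp: X_def S_def)
    then show "p \<in> hex_lattice" using \<phi>_lattice by (simp add: hex_lattice_diff)
  qed
  moreover have "finite X" using D' finS by (simp add: X_def)
  ultimately have 2: "card X * (sqrt 3 / 2) \<le> pi * ((r + 2 * s) / 2 + 1)\<^sup>2"
    using X_diam r s by (intro card_hex_lattice_diameter_le) auto
  show thesis
    by (rule that[OF 1])
      (use 2 card_hex_lattice_cball_ge[OF s] in \<open>simp_all add: S_def add_divide_distrib\<close>)
qed

section \<open>The optimal radius\<close>

text \<open>Completing the square gives \<open>(m - b / 2)^2 <= q^2 + b^2 / 4\<close>; then
  \<open>sqrt (q^2 + x) <= q + x / (2 * q)\<close> is used with \<open>x = b^2 / 4\<close>.\<close>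

lemma quadratic_upper_bound:
  fixes m b q :: real
  assumes "m\<^sup>2 \<le> q\<^sup>2 + b * m" "0 < q" "0 \<le> b"
  shows "m \<le> q + b / 2 + b\<^sup>2 / (8 * q)"
proof (rule ccontr)
  define e where "e = b\<^sup>2 / (8 * q)"
  assume "\<not> ?thesis"
  then have "q + e < m - b / 2" by (simp add: e_def)
  moreover have "0 \<le> e" using assms by (simp add: e_def)
  ultimately have "(q + e)\<^sup>2 < (m - b / 2)\<^sup>2" using assms by (intro power_strict_mono) auto
  also have "\<dots> \<le> q\<^sup>2 + b\<^sup>2 / 4" using assms(1) by (simp add: power2_eq_square field_simps)
  finally have "2 * q * e + e\<^sup>2 < b\<^sup>2 / 4" by (simp add: power2_eq_square algebra_simps)
  moreover have "2 * q * e = b\<^sup>2 / 4" using assms(2) by (simp add: e_def)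
  ultimately show False using zero_le_power2[of e] by linarith
qed

text \<open>A disc of radius \<open>t\<close> has area \<open>\<kappa>^2 * t^2\<close> in units of
  one brick. The value \<open>c\<close> is the critical point of
  \<open>\<kappa> * c + 1 / (8 * c^2)\<close>, given by \<open>c^3 = 1 / (4 * \<kappa>)\<close>;
  there the second term is half the first.\<close>

lemma hex_constants:
  fixes \<kappa> c :: real
  assumes \<kappa>: "\<kappa> = sqrt (2 * pi / sqrt 3)" and c: "c = (1 / (4 * \<kappa>)) powr (1/3)"
  shows "\<kappa> / 2 = sqrt pi / (sqrt 2 * 3 powr (1/4))"
    and "\<kappa> * c + 1 / (8 * c\<^sup>2) = 3 powr (5/6) * pi powr (1/3) / 2 powr (4/3)"
proof -
  have pos: "0 < \<kappa>" "0 < c" unfolding \<kappa> c by auto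
  have q: "sqrt (sqrt 3) = 3 powr (1/4)" by (simp add: powr_powr flip: powr_half_sqrt)
  have "\<kappa> = sqrt 2 * sqrt pi / 3 powr (1/4)"
    by (simp add: \<kappa> real_sqrt_divide real_sqrt_mult q)
  then have "\<kappa> / 2 = sqrt 2 * sqrt pi / (sqrt 2 * sqrt 2 * 3 powr (1/4))" by simp
  also have "\<dots> = sqrt pi / (sqrt 2 * 3 powr (1/4))" by (simp del: real_sqrt_mult_self)
  finally show "\<kappa> / 2 = sqrt pi / (sqrt 2 * 3 powr (1/4))" .
  have c3: "c ^ 3 = 1 / (4 * \<kappa>)" unfolding c using pos
    by (simp add: powr_powr flip: powr_numeral)
  have \<kappa>2: "\<kappa>\<^sup>2 = 2 * pi / sqrt 3" by (simp add: \<kappa>)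
  define R where "R = 3 powr (5/6) * pi powr (1/3) / 2 powr (4/3)"
  have "1 / (8 * c\<^sup>2) = c / (8 * c ^ 3)" using pos by (simp add: power2_eq_square power3_eq_cube)
  also have "\<dots> = \<kappa> * c / 2" using pos by (simp add: c3)
  finally have L: "\<kappa> * c + 1 / (8 * c\<^sup>2) = 3/2 * \<kappa> * c" by simp
  \<comment> \<open>Cubing removes the cube roots, and positivity allows the comparison of
    cubes.\<close>
  have "(3/2 * \<kappa> * c) ^ 3 = 27/8 * \<kappa> ^ 3 * c ^ 3" by (simp add: power_mult_distrib power_divide)
  also have "\<dots> = 27/8 * \<kappa>\<^sup>2 * (\<kappa> * c ^ 3)" by (simp add: power2_eq_square power3_eq_cube)
  also have "\<dots> = 27/32 * \<kappa>\<^sup>2" using pos by (simp add: c3)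
  also have "\<dots> = 27/16 * pi / sqrt 3" by (simp add: \<kappa>2)
  also have "\<dots> = 9/16 * pi * sqrt 3" by (simp add: field_simps)
  also have "\<dots> = R ^ 3"
  proof -
    have "((3::real) powr (5/6)) ^ 3 = 3 powr (2 + 1/2)" by (simp add: powr_powr flip: powr_numeral)
    also have "\<dots> = 9 * sqrt 3" by (subst powr_add) (simp add: powr_half_sqrt)
    finally have a: "((3::real) powr (5/6)) ^ 3 = 9 * sqrt 3" .
    have b: "(pi powr (1/3)) ^ 3 = pi" by (simp add: powr_powr flip: powr_numeral)
    have "((2::real) powr (4/3)) ^ 3 = 2 powr 4" by (simp add: powr_powr flip: powr_numeral)
    then have d: "((2::real) powr (4/3)) ^ 3 = 16" by simp
    show ?thesis unfolding R_def power_mult_distrib power_divide a b d by simp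
  qed
  finally have "(3/2 * \<kappa> * c) ^ 3 = R ^ 3" .
  then have "3/2 * \<kappa> * c = R" using pos by (simp add: R_def power_eq_iff_eq_base)
  then show "\<kappa> * c + 1 / (8 * c\<^sup>2) = 3 powr (5/6) * pi powr (1/3) / 2 powr (4/3)"
    by (simp add: L R_def)
qed

section \<open>Choice of the radius and collection of the error terms\<close>

theorem theorem9:
  shows "\<exists>C::real. \<forall>r::nat. \<forall>m::nat. r \<ge> 1 \<longrightarrow> (\<exists>D. DD_star m (real r) D) \<longrightarrow>
    real m \<le> sqrt pi / (sqrt 2 * 3 powr (1/4)) * real r
      + 3 powr (5/6) * pi powr (1/3) / 2 powr (4/3) * real r powr (2/3)
      + C * real r powr (1/3)"
proof -
  define \<kappa> :: real where "\<kappa> = sqrt (2 * pi / sqrt 3)"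
  define c :: real where "c = (1 / (4 * \<kappa>)) powr (1/3)"
  have pos: "0 < \<kappa>" "0 < c" unfolding \<kappa>_def c_def by auto
  have \<kappa>2: "\<kappa>\<^sup>2 = pi / (sqrt 3 / 2)" by (simp add: \<kappa>_def)
  \<comment> \<open>\<open>K\<close> and \<open>K'\<close> are chosen so that
    \<open>w / (s - 1)\<close> below is at most \<open>u / (2 * c) + K\<close>, hence at most
    \<open>K' * u\<close>. The summands of \<open>C\<close> absorb the remainders of
    \<open>q\<close>, \<open>b / 2\<close> and \<open>b^2 / (8 * q)\<close>, in this order.\<close>
  define K where "K = 1 + 3 / c"
  define K' where "K' = 1 / (2 * c) + K"
  define C where "C = 3 * \<kappa> + (K / c + K\<^sup>2) / 2 + K' ^ 4 / (4 * \<kappa>)"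
  have Kpos: "0 < K" "0 < K'" using pos by (auto simp: K_def K'_def add_pos_pos)
  have main: "real m \<le> \<kappa> / 2 * r + (\<kappa> * c + 1 / (8 * c\<^sup>2)) * r powr (2/3) + C * r powr (1/3)"
    if "r \<ge> 1" and D: "DD_star m (real r) D" for r m :: nat and D
  proof -
    \<comment> \<open>In terms of the cube root of \<open>r\<close>, the bound becomes a polynomial
      in \<open>u\<close>.\<close>
    define u where "u = real r powr (1/3)"
    have u1: "1 \<le> u" using that by (simp add: u_def ge_one_powr_ge_zero)
    have u2: "real r powr (2/3) = u\<^sup>2" and u3: "real r = u ^ 3"
      using that by (simp_all add: u_def powr_powr flip: powr_numeral)
    \<comment> \<open>The summand 2 keeps \<open>s - 1\<close> positive for small \<open>r\<close> and costs only a constant.\<close>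
    define s where "s = c * u\<^sup>2 + 2"
    have s1: "1 \<le> s" using pos by (simp add: s_def)
    obtain N a :: nat where Na: "a * m\<^sup>2 \<le> N * (a + m)"
      and N: "N * (sqrt 3 / 2) \<le> pi * (r / 2 + s + 1)\<^sup>2"
      and a: "pi * (s - 1)\<^sup>2 \<le> a * (sqrt 3 / 2)"
      using DD_star_count[OF D s1] of_nat_0_le_iff by metis
    \<comment> \<open>\<open>q^2\<close> will bound \<open>N\<close> and \<open>b\<close> will bound
      \<open>N / a\<close>; dividing the count by \<open>a\<close> then gives a quadratic inequality
      for \<open>m\<close>.\<close>
    define w where "w = r / 2 + s + 1"
    define q where "q = \<kappa> * w"
    define b where "b = (w / (s - 1))\<^sup>2"
    have w: "0 < w" using s1 by (simp add: w_def)
    have sm: "0 < s - 1" using pos by (simp add: s_def add_pos_nonneg)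
    have qpos: "0 < q" using pos w by (simp add: q_def)
    have "N \<le> pi * w\<^sup>2 / (sqrt 3 / 2)"
      using N unfolding w_def by (subst pos_le_divide_eq) simp_all
    then have N': "N \<le> q\<^sup>2" by (simp add: q_def power_mult_distrib \<kappa>2 mult_ac)
    have "pi * (s - 1)\<^sup>2 / (sqrt 3 / 2) \<le> a"
      using a by (subst pos_divide_le_eq) simp_all
    then have a': "\<kappa>\<^sup>2 * (s - 1)\<^sup>2 \<le> a" by (simp add: \<kappa>2 mult_ac)
    have apos: "0 < real a" using a' pos sm by (smt (verit) mult_pos_pos zero_less_power)
    have "N / a \<le> q\<^sup>2 / (\<kappa>\<^sup>2 * (s - 1)\<^sup>2)"
      using N' a' pos sm by (intro frac_le) auto
    also have "\<dots> = b" using pos by (simp add: q_def b_def power_mult_distrib power_divide)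
    finally have Nb: "N / a \<le> b" .
    have "real (a * m\<^sup>2) \<le> real (N * (a + m))" using Na by (simp only: of_nat_le_iff)
    then have "(real m)\<^sup>2 \<le> N + N / a * m" using apos by (simp add: field_simps power2_eq_square)
    also have "\<dots> \<le> q\<^sup>2 + b * m" using N' Nb by (intro add_mono mult_right_mono) auto
    finally have m_le: "real m \<le> q + b / 2 + b\<^sup>2 / (8 * q)"
      using qpos by (rule quadratic_upper_bound) (simp add: b_def)
    have q_eq: "q = \<kappa> / 2 * u ^ 3 + \<kappa> * c * u\<^sup>2 + 3 * \<kappa>"
      by (simp add: q_def w_def s_def u3 algebra_simps)
    have "w / (s - 1) \<le> u / (2 * c) + K"
    proof -
      have "w / (s - 1) \<le> w / (c * u\<^sup>2)"
        using w pos u1 sm by (intro divide_left_mono mult_pos_pos) (simp_all add: s_def)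
      also have "\<dots> = u / (2 * c) + 1 + 3 / (c * u\<^sup>2)"
        using pos u1 by (simp add: w_def s_def u3 field_simps power2_eq_square power3_eq_cube)
      also have "3 / (c * u\<^sup>2) \<le> 3 / c" using pos u1 by (intro divide_left_mono) auto
      finally show ?thesis by (simp add: K_def)
    qed
    then have b_le: "b \<le> (u / (2 * c) + K)\<^sup>2"
      unfolding b_def using w sm by (intro power_mono) auto
    have "(u / (2 * c) + K)\<^sup>2 = u\<^sup>2 / (4 * c\<^sup>2) + K / c * u + K\<^sup>2"
      using pos by (simp add: power2_eq_square field_simps)
    also have "\<dots> \<le> u\<^sup>2 / (4 * c\<^sup>2) + K / c * u + K\<^sup>2 * u"
      using u1 mult_left_mono[of 1 u "K\<^sup>2"] by simp
    \<comment> \<open>This supplies the term \<open>1 / (8 * c^2)\<close> of the second coefficient;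
      \<open>q\<close> supplies \<open>\<kappa> * c\<close>.\<close>
    finally have b2: "b / 2 \<le> 1 / (8 * c\<^sup>2) * u\<^sup>2 + (K / c + K\<^sup>2) / 2 * u"
      using b_le by (simp add: field_simps)
    \<comment> \<open>\<open>b\<close> has order at most \<open>u^2\<close> while \<open>q\<close>
      has order \<open>u^3\<close>, so the quotient is linear in \<open>u\<close>.\<close>
    have b3: "b\<^sup>2 / (8 * q) \<le> K' ^ 4 / (4 * \<kappa>) * u"
    proof -
      have "u / (2 * c) + K \<le> K' * u"
        using mult_left_mono[of 1 u K] u1 Kpos by (simp add: K'_def distrib_right)
      then have "(u / (2 * c) + K)\<^sup>2 \<le> (K' * u)\<^sup>2"
        by (rule power_mono) (use pos Kpos u1 in simp)
      with b_le have "b \<le> (K' * u)\<^sup>2" by simp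
      then have "b\<^sup>2 \<le> ((K' * u)\<^sup>2)\<^sup>2" by (intro power_mono) (auto simp: b_def)
      moreover have "4 * \<kappa> * u ^ 3 \<le> 8 * q"
      proof -
        have "0 \<le> \<kappa> * c * u\<^sup>2" using pos by simp
        then show ?thesis using pos by (simp add: q_eq distrib_left)
      qed
      ultimately have "b\<^sup>2 / (8 * q) \<le> ((K' * u)\<^sup>2)\<^sup>2 / (4 * \<kappa> * u ^ 3)"
        using pos u1 by (intro frac_le) auto
      also have "\<dots> = K' ^ 4 / (4 * \<kappa>) * u"
        using pos u1 by (simp add: field_simps eval_nat_numeral)
      finally show ?thesis .
    qed
    have "3 * \<kappa> \<le> 3 * \<kappa> * u" using pos u1 by simp
    with m_le q_eq b2 b3 have "real m \<le> \<kappa> / 2 * u ^ 3 + (\<kappa> * c + 1 / (8 * c\<^sup>2)) * u\<^sup>2 + C * u"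
      unfolding C_def distrib_right by linarith
    then show ?thesis unfolding u2 u3[symmetric] by (simp add: u_def)
  qed
  show ?thesis
    using main unfolding hex_constants[OF \<kappa>_def c_def] by blast
qed

end
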